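(* Let $d$ be odd, let $\Gamma\subseteq\mathrm{Sym}(N)$ be a permutation group, and let $v,\bar v\in\mathcal{S}_d(\Gamma)$ be irreducible and flexible arrangements. Then $v$ and $\bar v$ are deformation equivalent if and only if they have isomorphic representations.
   Context: Let $n,d\ge 1$ and $N=\{1,\dots,n\}$. A $d$-dimensional arrangement is a family of points $v_i\in\mathbb{R}^d$, $i\in N$; its matrix $M\in\mathbb{R}^{n\times d}$ has $i$-th row $v_i^\top$ and its arrangement space is the column span $U=\mathrm{span}\,M\subseteq\mathbb{R}^n$. Two arrangements are equivalent if they have the same arrangement space. An arrangement is normalized if $M^\top M=\mathrm{Id}$. For a permutation group $\Gamma\subseteq\mathrm{Sym}(N)$, $v$ is a $\Gamma$-arrangement if there is a group homomorphism $T\colon\Gamma\to\mathrm{O}(\mathbb{R}^d)$ with $T_\phi v_i=v_{\phi(i)}$ for all $i\in N$, $\phi\in\Gamma$; $T$ is called the representation of $v$ (it is unique if the $v_i$ span $\mathbb{R}^d$, in particular if $v$ is normalized). $v$ is irreducible if its representation is irreducible over $\mathbb{R}$. Two representations $T,\bar T$ are isomorphic if there is an invertible linear map $R$ with $RT_\phi=\bar T_\phi R$ for all $\phi\in\Gamma$. $\mathcal{S}_d(\Gamma)$ is the set of $d$-dimensional normalized $\Gamma$-arrangements on $N$, with the subspace topology from $(\mathbb{R}^d)^n$. Two arrangements $v,\bar v\in\mathcal{S}_d(\Gamma)$ are deformation equivalent ($v$ can be deformed into $\bar v$) if there is a continuous map $v(\cdot)\colon[0,1]\to\mathcal{S}_d(\Gamma)$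 with $v(0)=v$ and $v(1)=\bar v$. An arrangement $v\in\mathcal{S}_d(\Gamma)$ is rigid if it cannot be deformed into any non-equivalent arrangement of $\mathcal{S}_d(\Gamma)$; otherwise it is flexible. *)

theory Defs
  imports "HOL-Analysis.Analysis" "HOL-Algebra.Bij"
begin

text \<open>
  The index set \<open>N\<close> is the universe of the finite type \<open>'n\<close>, and \<open>\<real>\<^sup>d\<close> is
  \<open>real^'d\<close>.  An arrangement \<open>v\<close> has type \<open>real^'d^'n\<close>: the point \<open>v\<^sub>i\<close> is \<open>v $ i\<close>.
  This type is at the same time that of the matrix \<open>M\<close> with rows \<open>v\<^sub>i\<close>, and its topology is
  that of \<open>(\<real>\<^sup>d)\<^sup>n\<close>.
  A permutation group is a subgroup of \<open>BijGroup UNIV\<close>, the symmetric group on \<open>'n\<close>.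
\<close>

definition arrangement_space :: "real^'d^'n \<Rightarrow> (real^'n) set" where
  "arrangement_space v = span (columns v)"

definition equivalent_arrangements :: "real^'d^'n \<Rightarrow> real^'d^'n \<Rightarrow> bool" where
  "equivalent_arrangements v w \<longleftrightarrow> arrangement_space v = arrangement_space w"

definition normalized :: "real^'d^'n \<Rightarrow> bool" where
  "normalized v \<longleftrightarrow> transpose v ** v = mat 1"

definition orthogonal_group :: "('a::euclidean_space \<Rightarrow> 'a) monoid" where
  "orthogonal_group = \<lparr>carrier = {f. orthogonal_transformation f}, mult = (\<circ>), one = id\<rparr>"

text \<open>
  Only the values of a representation on the group matter; as a HOL function it is
  unconstrained elsewhere.
\<close>

definition orthogonal_representation ::
    "('n \<Rightarrow> 'n) set \<Rightarrow> (('n \<Rightarrow> 'n) \<Rightarrow> real^'d \<Rightarrow> real^'d) \<Rightarrow> bool" where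
  "orthogonal_representation \<Gamma> T \<longleftrightarrow>
     T \<in> hom (BijGroup UNIV\<lparr>carrier := \<Gamma>\<rparr>) orthogonal_group"

definition irreducible_representation ::
    "('n \<Rightarrow> 'n) set \<Rightarrow> (('n \<Rightarrow> 'n) \<Rightarrow> real^'d \<Rightarrow> real^'d) \<Rightarrow> bool" where
  "irreducible_representation \<Gamma> T \<longleftrightarrow>
     (\<forall>W. subspace W \<and> (\<forall>\<phi>\<in>\<Gamma>. T \<phi> ` W \<subseteq> W) \<longrightarrow> W = {0} \<or> W = UNIV)"

definition isomorphic_representations ::
    "('n \<Rightarrow> 'n) set \<Rightarrow> (('n \<Rightarrow> 'n) \<Rightarrow> real^'d \<Rightarrow> real^'d) \<Rightarrow>
      (('n \<Rightarrow> 'n) \<Rightarrow> real^'d \<Rightarrow> real^'d) \<Rightarrow> bool" where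
  "isomorphic_representations \<Gamma> T T' \<longleftrightarrow>
     (\<exists>R. linear R \<and> bij R \<and> (\<forall>\<phi>\<in>\<Gamma>. R \<circ> T \<phi> = T' \<phi> \<circ> R))"

definition representation_of ::
    "('n \<Rightarrow> 'n) set \<Rightarrow> real^'d^'n \<Rightarrow> (('n \<Rightarrow> 'n) \<Rightarrow> real^'d \<Rightarrow> real^'d) \<Rightarrow> bool" where
  "representation_of \<Gamma> v T \<longleftrightarrow>
     orthogonal_representation \<Gamma> T \<and> (\<forall>\<phi>\<in>\<Gamma>. \<forall>i. T \<phi> (v $ i) = v $ \<phi> i)"

definition symmetric_arrangement :: "('n \<Rightarrow> 'n) set \<Rightarrow> real^'d^'n \<Rightarrow> bool" where
  "symmetric_arrangement \<Gamma> v \<longleftrightarrow> (\<exists>T. representation_of \<Gamma> v T)"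

definition normalized_arrangements :: "('n \<Rightarrow> 'n) set \<Rightarrow> (real^'d^'n) set" where
  "normalized_arrangements \<Gamma> = {v. symmetric_arrangement \<Gamma> v \<and> normalized v}"

text \<open>
  For a normalized arrangement the representation is unique on \<open>\<Gamma>\<close> (lemma
  \<open>representation_of_unique\<close> below), so the existential quantifiers in the next two
  definitions only pick out the representation.
\<close>

definition irreducible_arrangement :: "('n \<Rightarrow> 'n) set \<Rightarrow> real^'d^'n \<Rightarrow> bool" where
  "irreducible_arrangement \<Gamma> v \<longleftrightarrow>
     (\<exists>T. representation_of \<Gamma> v T \<and> irreducible_representation \<Gamma> T)"

definition have_isomorphic_representations ::
    "('n \<Rightarrow> 'n) set \<Rightarrow> real^'d^'n \<Rightarrow> real^'d^'n \<Rightarrow> bool" where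
  "have_isomorphic_representations \<Gamma> v w \<longleftrightarrow>
     (\<exists>T T'. representation_of \<Gamma> v T \<and> representation_of \<Gamma> w T' \<and>
        isomorphic_representations \<Gamma> T T')"

definition deformation_equivalent ::
    "('n \<Rightarrow> 'n) set \<Rightarrow> real^'d^'n \<Rightarrow> real^'d^'n \<Rightarrow> bool" where
  "deformation_equivalent \<Gamma> v w \<longleftrightarrow> path_component (normalized_arrangements \<Gamma>) v w"

definition rigid :: "('n \<Rightarrow> 'n) set \<Rightarrow> real^'d^'n \<Rightarrow> bool" where
  "rigid \<Gamma> v \<longleftrightarrow>
     \<not> (\<exists>w\<in>normalized_arrangements \<Gamma>. deformation_equivalent \<Gamma> v w \<and> \<not> equivalent_arrangements v w)"

abbreviation flexible :: "('n \<Rightarrow> 'n) set \<Rightarrow> real^'d^'n \<Rightarrow> bool" where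
  "flexible \<Gamma> v \<equiv> \<not> rigid \<Gamma> v"

lemma representation_of_unique:
  fixes v :: "real^'d^'n"
  assumes "normalized v" "representation_of \<Gamma> v T" "representation_of \<Gamma> v T'" "\<phi> \<in> \<Gamma>"
  shows "T \<phi> = T' \<phi>"
proof -
  have T: "orthogonal_transformation (T \<phi>)" "orthogonal_transformation (T' \<phi>)"
    using assms by (auto simp: representation_of_def orthogonal_representation_def
        orthogonal_group_def hom_def)
  have "span (rows v) = UNIV"
    using assms(1) matrix_left_invertible_span_rows[of v] by (auto simp: normalized_def)
  moreover have "T \<phi> x = T' \<phi> x" if "x \<in> rows v" for x
  proof -
    have "\<exists>i. x = v $ i"
      using that by (auto simp: rows_def row_def)
    then show ?thesis
      using assms by (auto simp add: representation_of_def)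
  qed
  ultimately have "T \<phi> x = T' \<phi> x" for x
    using linear_eq_on_span[of "T \<phi>" "T' \<phi>" "rows v"] T
    by (auto simp: orthogonal_transformation_def)
  then show ?thesis by auto
qed

end

theory Submission
  imports Defs
begin

text \<open>
  Everything rests on one operator: for arrangements \<open>v\<close> and \<open>w\<close> with representations \<open>T\<close> and
  \<open>T'\<close>, the matrix \<open>transpose w ** v\<close>, that is \<open>x \<mapsto> \<Sum>\<^sub>i (v\<^sub>i \<bullet> x) w\<^sub>i\<close>, intertwines \<open>T\<close> with \<open>T'\<close>,
  because a permutation in \<open>\<Gamma>\<close> only reorders the sum (\<open>gram_intertwines\<close>).

  A deformation preserves the representation up to isomorphism: along a path this operator is
  the identity for \<open>w = v\<close>, hence invertible for \<open>w\<close> near \<open>v\<close>.  So the isomorphism class is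
  locally constant on the path, and the path is connected
  (\<open>deformation_imp_isomorphic_representations\<close>).

  For the converse, odd dimension enters twice, both times through \<open>det (- A) = - det A\<close>:
  a connected set of matrices containing \<open>A\<close> and \<open>- A\<close> contains a singular one
  (\<open>connected_antipodal_singular\<close>).
  \<^item> Every matrix has a real eigenvalue, so by Schur's argument only scalars commute with an
    irreducible \<open>T\<close>.  Hence every family \<open>u\<close> with representation \<open>T\<close> has
    \<open>transpose u ** u\<close> scalar (\<open>irreducible_gram_scalar\<close>): in the linear space of these
    families, the normalized ones form a sphere.
  \<^item> For orthogonal \<open>Q\<close>, one of \<open>Q\<close> and \<open>- Q\<close> is joined to the identity by orthogonal matrices
    (\<open>odd_dimension_orthogonal_component\<close>): the orthogonal group has at most two path
    components, and \<open>Q\<close>, \<open>- Q\<close> cannot share one.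

  Suppose \<open>v\<close> and \<open>w\<close> have isomorphic representations.  Transporting \<open>v\<close> by an isomorphism gives
  a family with the representation \<open>T\<close> of \<open>w\<close>.  Its Gram matrix is scalar, so the isomorphism is
  a multiple of an orthogonal matrix, which up to sign is joined to the identity.  So \<open>v\<close> deforms
  into some \<open>u\<close> on the sphere of normalized families with representation \<open>T\<close>
  (\<open>deform_into_representation\<close>).  Two points of that sphere that are not antipodal are joined
  by an arc (\<open>same_representation_not_antipodal\<close>).  If \<open>u = - w\<close>, flexibility is needed: a
  non-equivalent deformation of \<open>w\<close>, brought back to the sphere in the same way, is a point
  different from \<open>w\<close> and \<open>- w\<close>, since these are equivalent, and the path goes through it.
\<close>

section \<open>Paths and matrix algebra\<close>

lemma path_component_continuous_image:
  assumes "path_component S x y" "continuous_on S f" "f ` S \<subseteq> T"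
  shows "path_component T (f x) (f y)"
proof -
  obtain g where g: "path g" "path_image g \<subseteq> S" "pathstart g = x" "pathfinish g = y"
    using assms(1) by (auto simp: path_component_def)
  have "path (f \<circ> g)"
    using g assms(2) by (meson path_continuous_image continuous_on_subset)
  moreover have "path_image (f \<circ> g) \<subseteq> T"
    using g(2) assms(3) by (auto simp: path_image_compose)
  ultimately show ?thesis
    using g by (auto simp: path_component_def pathstart_compose pathfinish_compose intro!: exI[of _ "f \<circ> g"])
qed

lemma continuous_on_matrix_mult [continuous_intros]:
  fixes f :: "'a::topological_space \<Rightarrow> real^'k^'m" and g :: "'a \<Rightarrow> real^'l^'k"
  assumes "continuous_on S f" "continuous_on S g"
  shows "continuous_on S (\<lambda>x. f x ** g x)"
  unfolding matrix_matrix_mult_def by (intro continuous_intros assms)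

lemma continuous_on_transpose [continuous_intros]:
  fixes f :: "'a::topological_space \<Rightarrow> real^'k^'m"
  assumes "continuous_on S f"
  shows "continuous_on S (\<lambda>x. transpose (f x))"
  unfolding transpose_def by (intro continuous_intros assms)

lemma continuous_on_det [continuous_intros]:
  fixes f :: "'a::topological_space \<Rightarrow> real^'k^'k"
  assumes "continuous_on S f"
  shows "continuous_on S (\<lambda>x. det (f x))"
  unfolding det_def by (intro continuous_intros assms)

lemma mat_mul_vector: "mat c *v x = c *\<^sub>R (x::real^'d)"
  by (simp add: vec_eq_iff matrix_vector_mult_def mat_def if_distrib[of "\<lambda>a. a * _"] cong: if_cong)

lemma uminus_matrix_mult: "(- A) ** B = - (A ** (B::real^'k^'d))"
  by (simp add: vec_eq_iff matrix_matrix_mult_def sum_negf)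

lemma matrix_mult_uminus: "A ** (- B) = - (A ** (B::real^'k^'d))"
  by (simp add: vec_eq_iff matrix_matrix_mult_def sum_negf)

lemma transpose_uminus: "transpose (- A) = - transpose (A::real^'k^'d)"
  by (simp add: vec_eq_iff transpose_def)

section \<open>Matrices in odd dimension\<close>

lemma det_uminus_odd:
  fixes A :: "real^'d^'d"
  assumes "odd CARD('d)"
  shows "det (- A) = - det A"
proof -
  have "det (- mat 1 :: real^'d^'d) = -1"
  proof -
    have eq: "(- mat 1 :: real^'d^'d) = matrix ((*\<^sub>R) (-1))"
      by (simp add: matrix_scaleR) (simp add: vec_eq_iff mat_def)
    show ?thesis
      unfolding eq det_matrix_scaleR using assms by simp
  qed
  moreover have "- A = - mat 1 ** A"
    by (simp add: uminus_matrix_mult)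
  ultimately show ?thesis
    by (simp add: det_mul)
qed

text \<open>
  The determinant takes opposite values at \<open>A\<close> and \<open>- A\<close>, so the intermediate value theorem
  gives a zero.  This is used to find eigenvalues and to separate an orthogonal matrix from its
  negative.
\<close>

lemma connected_antipodal_singular:
  fixes S :: "(real^'d^'d) set"
  assumes "odd CARD('d)" "connected S" "A \<in> S" "- A \<in> S"
  obtains B where "B \<in> S" "det B = 0"
proof -
  have conn: "connected (det ` S)"
    by (intro connected_continuous_image continuous_intros assms)
  have "0 \<in> det ` S"
  proof (cases "det A \<le> 0")
    case True
    have "- det A \<in> det ` S"
      using assms(4) det_uminus_odd[OF assms(1), of A] by (metis imageI)
    then show ?thesis
      using True assms(3) connectedD_interval[OF conn, of "det A" "- det A" 0] by auto
  next
    case False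
    have "- det A \<in> det ` S"
      using assms(4) det_uminus_odd[OF assms(1), of A] by (metis imageI)
    then show ?thesis
      using False assms(3) connectedD_interval[OF conn, of "- det A" "det A" 0] by auto
  qed
  then show ?thesis
    using that by auto
qed

text \<open>
  The half circle \<open>cos t \<sqdot> 1 + sin t \<sqdot> A\<close>, \<open>0 \<le> t \<le> \<pi>\<close>, joins the identity to its negative, so it
  contains a singular matrix.  Where it is singular, \<open>sin t \<noteq> 0\<close>, and the kernel consists of
  eigenvectors of \<open>A\<close> for \<open>- cot t\<close>.
\<close>

lemma odd_dimension_eigenvector:
  fixes A :: "real^'d^'d"
  assumes "odd CARD('d)"
  obtains c x where "x \<noteq> 0" "A *v x = c *\<^sub>R x"
proof -
  define \<gamma> where "\<gamma> t = cos t *\<^sub>R mat 1 + sin t *\<^sub>R A" for t :: real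
  have "connected (\<gamma> ` {0..pi})"
    unfolding \<gamma>_def by (intro connected_continuous_image continuous_intros) auto
  moreover have "mat 1 \<in> \<gamma> ` {0..pi}"
    by (rule image_eqI[of _ _ 0]) (auto simp: \<gamma>_def)
  moreover have "- mat 1 \<in> \<gamma> ` {0..pi}"
    by (rule image_eqI[of _ _ pi]) (auto simp: \<gamma>_def)
  ultimately obtain t where t: "det (\<gamma> t) = 0"
    using connected_antipodal_singular[OF assms] by blast
  then obtain x where x: "x \<noteq> 0" "\<gamma> t *v x = 0"
    by (metis invertible_det_nz invertible_left_inverse matrix_left_invertible_ker)
  then have eq: "cos t *\<^sub>R x + sin t *\<^sub>R (A *v x) = 0"
    by (simp add: \<gamma>_def matrix_vector_mult_add_rdistrib flip: scaleR_matrix_vector_assoc)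
  have "sin t \<noteq> 0"
  proof
    assume s: "sin t = 0"
    then have "cos t \<noteq> 0"
      using sin_cos_squared_add[of t] by auto
    then show False
      using eq x(1) s by simp
  qed
  then have "A *v x = (- cos t / sin t) *\<^sub>R x"
    using eq by (smt (verit) add_eq_0_iff divide_inverse_commute mult_minus_right real_vector_affinity_eq
        scaleR_scaleR vector_fraction_eq_iff scaleR_minus_left scaleR_zero_right)
  then show ?thesis
    using that x(1) by blast
qed

section \<open>Path components of the orthogonal group\<close>

definition reflection_matrix :: "real^'d \<Rightarrow> real^'d^'d" where
  "reflection_matrix u = mat 1 - (2 / (u \<bullet> u)) *\<^sub>R (\<chi> i j. u $ i * u $ j)"

lemma reflection_matrix_apply:
  "reflection_matrix u *v x = x - (2 * (u \<bullet> x) / (u \<bullet> u)) *\<^sub>R u"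
proof -
  have "(\<chi> i j. u $ i * u $ j) *v x = (u \<bullet> x) *\<^sub>R u"
    by (simp add: vec_eq_iff matrix_vector_mult_def inner_vec_def sum_distrib_left mult_ac)
  then show ?thesis
    by (simp add: reflection_matrix_def matrix_vector_mult_diff_rdistrib flip: scaleR_matrix_vector_assoc)
qed

lemma reflection_matrix_involution:
  assumes "u \<noteq> 0"
  shows "reflection_matrix u ** reflection_matrix u = mat 1"
  unfolding matrix_eq using assms
  by (simp add: reflection_matrix_apply mat_mul_vector inner_diff_right flip: matrix_vector_mul_assoc)

lemma orthogonal_reflection_matrix:
  assumes "u \<noteq> 0"
  shows "orthogonal_matrix (reflection_matrix u)"
proof -
  have "transpose (reflection_matrix u) = reflection_matrix u"
    by (simp add: vec_eq_iff reflection_matrix_def transpose_def mat_def mult.commute)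
  then show ?thesis
    by (simp add: orthogonal_matrix reflection_matrix_involution assms)
qed

lemma reflection_matrix_scaleR:
  assumes "c \<noteq> 0"
  shows "reflection_matrix (c *\<^sub>R u) = reflection_matrix u"
  using assms by (cases "u = 0") (auto simp: matrix_eq reflection_matrix_apply)

text \<open>
  Move the normal vector along the segment from \<open>u\<close> to \<open>w\<close>.  This fails only if the segment
  passes through \<open>0\<close>; then \<open>w\<close> is a multiple of \<open>u\<close> and the two reflections coincide.
\<close>

lemma path_component_reflections:
  fixes u w :: "real^'d"
  assumes "u \<noteq> 0" "w \<noteq> 0"
  shows "path_component (Collect orthogonal_matrix) (reflection_matrix u) (reflection_matrix w)"
proof (cases "0 \<in> closed_segment u w")
  case True
  then obtain t where t: "0 \<le> t" "t \<le> 1" "(1 - t) *\<^sub>R u + t *\<^sub>R w = 0"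
    by (auto simp: closed_segment_def)
  have "t \<noteq> 0" "t \<noteq> 1"
    using t assms by auto
  have "w = (- (1 - t) / t) *\<^sub>R u"
    using t(3) \<open>t \<noteq> 0\<close>
    by (metis (no_types, lifting) add_eq_0_iff minus_minus divide_inverse_commute scaleR_minus_left scaleR_scaleR
        right_inverse scaleR_one mult.commute)
  then have "reflection_matrix w = reflection_matrix u"
    using reflection_matrix_scaleR[of "- (1 - t) / t" u] \<open>t \<noteq> 0\<close> \<open>t \<noteq> 1\<close> by simp
  then show ?thesis
    using assms by (simp add: path_component_refl orthogonal_reflection_matrix)
next
  case False
  have "path_component (closed_segment u w) u w"
    using path_connected_component by (metis convex_closed_segment convex_imp_path_connected ends_in_segment)
  moreover have "continuous_on (closed_segment u w) reflection_matrix"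
    unfolding reflection_matrix_def using False by (intro continuous_intros) auto
  moreover have "reflection_matrix ` closed_segment u w \<subseteq> Collect orthogonal_matrix"
    using False by (auto intro: orthogonal_reflection_matrix)
  ultimately show ?thesis
    by (rule path_component_continuous_image)
qed

lemma path_component_orthogonal_mult:
  fixes A B C :: "real^'d^'d"
  assumes "path_component (Collect orthogonal_matrix) A B" "orthogonal_matrix C"
  shows "path_component (Collect orthogonal_matrix) (A ** C) (B ** C)"
  by (rule path_component_continuous_image[OF assms(1)])
     (use assms(2) in \<open>auto intro!: continuous_intros orthogonal_matrix_mul\<close>)

lemma orthogonal_matrix_inner:
  "orthogonal_matrix Q \<Longrightarrow> (Q *v x) \<bullet> (Q *v y) = x \<bullet> (y :: real^'d)"
  by (metis (no_types) dot_lmul_matrix matrix_vector_mul_assoc matrix_vector_mul_lid orthogonal_matrix transpose_matrix_vector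
      inner_commute)

text \<open>
  The argument of Cartan and Dieudonne: \<open>Q\<close> is a product of reflections.  All reflections lie in
  one path component, so each factor may be replaced by the reflection along \<open>e\<close>, and pairs of
  equal factors cancel.  The induction is on the number of standard basis vectors moved by \<open>Q\<close>.
\<close>

lemma orthogonal_component_identity_or_reflection:
  fixes Q :: "real^'d^'d" and e :: "real^'d"
  assumes "orthogonal_matrix Q" "e \<noteq> 0"
  shows "path_component (Collect orthogonal_matrix) Q (mat 1) \<or>
         path_component (Collect orthogonal_matrix) Q (reflection_matrix e)"
  using assms(1)
proof (induction "card {i. Q *v axis i 1 \<noteq> axis i 1}" arbitrary: Q rule: less_induct)
  case less
  let ?P = "path_component (Collect (orthogonal_matrix :: real^'d^'d \<Rightarrow> bool))"
  show ?case
  proof (cases "\<exists>i. Q *v axis i 1 \<noteq> axis i 1")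
    case False
    then have "column i Q = column i (mat 1)" for i
      by (metis matrix_vector_mul_lid matrix_vector_mult_basis)
    then have "Q = mat 1"
      by (simp add: vec_eq_iff column_def)
    then show ?thesis
      by (simp add: path_component_refl orthogonal_matrix_id)
  next
    case True
    then obtain i where i: "Q *v axis i 1 \<noteq> axis i 1" by blast
    \<comment> \<open>The reflection that sends \<open>Q e\<^sub>i\<close> back to \<open>e\<^sub>i\<close>; it fixes each \<open>e\<^sub>j\<close> that \<open>Q\<close> fixes,
      because then \<open>u\<close> is orthogonal to \<open>e\<^sub>j\<close>.\<close>
    define u where "u = Q *v axis i 1 - axis i 1"
    define Q' where "Q' = reflection_matrix u ** Q"
    have u: "u \<noteq> 0"
      using i by (simp add: u_def)
    have orth: "orthogonal_matrix Q'"
      unfolding Q'_def using less.prems u by (intro orthogonal_matrix_mul orthogonal_reflection_matrix)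
    have inner: "(Q *v x) \<bullet> (Q *v y) = x \<bullet> y" for x y
      using less.prems by (rule orthogonal_matrix_inner)
    have "Q' *v axis i 1 = axis i 1"
    proof -
      have "2 * (u \<bullet> (Q *v axis i 1)) = u \<bullet> u"
        using inner[of "axis i 1" "axis i 1"]
        by (simp add: u_def inner_diff_left inner_diff_right inner_commute)
      then show ?thesis
        using u by (simp add: Q'_def reflection_matrix_apply u_def flip: matrix_vector_mul_assoc)
    qed
    moreover have "Q' *v axis j 1 = axis j 1" if "Q *v axis j 1 = axis j 1" for j
    proof -
      have "u \<bullet> axis j 1 = 0"
        using inner[of "axis i 1" "axis j 1"] that by (simp add: u_def inner_diff_left)
      then show ?thesis
        using that by (simp add: Q'_def reflection_matrix_apply flip: matrix_vector_mul_assoc)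
    qed
    ultimately have "{j. Q' *v axis j 1 \<noteq> axis j 1} \<subset> {j. Q *v axis j 1 \<noteq> axis j 1}"
      using i by blast
    then have "card {j. Q' *v axis j 1 \<noteq> axis j 1} < card {j. Q *v axis j 1 \<noteq> axis j 1}"
      by (intro psubset_card_mono) auto
    from less.hyps[OF this orth]
    have IH: "?P Q' (mat 1) \<or> ?P Q' (reflection_matrix e)" .
    have flip: "?P Q (reflection_matrix e ** Q')"
    proof -
      have "Q = reflection_matrix u ** Q'"
        by (simp add: Q'_def matrix_mul_assoc reflection_matrix_involution u)
      then show ?thesis
        using path_component_orthogonal_mult[OF path_component_reflections[OF u assms(2)] orth] by simp
    qed
    have left: "?P (reflection_matrix e ** Q') (reflection_matrix e ** B)" if "?P Q' B" for B
      by (rule path_component_continuous_image[OF that])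
         (use assms(2) in \<open>auto intro!: continuous_intros orthogonal_matrix_mul orthogonal_reflection_matrix\<close>)
    show ?thesis
      using IH left flip reflection_matrix_involution[OF assms(2)]
      by (metis matrix_mul_rid path_component_trans)
  qed
qed

lemma orthogonal_matrix_uminus: "orthogonal_matrix (- Q) \<longleftrightarrow> orthogonal_matrix (Q :: real^'d^'d)"
  by (simp add: orthogonal_matrix transpose_uminus uminus_matrix_mult matrix_mult_uminus)

text \<open>
  If neither \<open>Q\<close> nor \<open>- Q\<close> were joined to the identity, both would be joined to the same
  reflection, hence to each other, and some orthogonal matrix on the path would be singular.
\<close>

lemma odd_dimension_orthogonal_component:
  fixes Q :: "real^'d^'d"
  assumes "odd CARD('d)" "orthogonal_matrix Q"
  shows "path_component (Collect orthogonal_matrix) Q (mat 1) \<or>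
         path_component (Collect orthogonal_matrix) (- Q) (mat 1)"
proof (rule ccontr)
  let ?P = "path_component (Collect (orthogonal_matrix :: real^'d^'d \<Rightarrow> bool))"
  assume neither: "\<not> (?P Q (mat 1) \<or> ?P (- Q) (mat 1))"
  obtain e :: "real^'d" where e: "e \<noteq> 0"
    by (meson axis_eq_0_iff one_neq_zero)
  have "?P Q (reflection_matrix e)" "?P (- Q) (reflection_matrix e)"
    using orthogonal_component_identity_or_reflection[OF _ e] assms(2) neither orthogonal_matrix_uminus by blast+
  then have "?P Q (- Q)"
    by (meson path_component_sym path_component_trans)
  then obtain g where g: "path g" "path_image g \<subseteq> Collect orthogonal_matrix"
      "pathstart g = Q" "pathfinish g = - Q"
    by (auto simp: path_component_def)
  obtain B where "B \<in> path_image g" "det B = 0"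
    using connected_antipodal_singular[OF assms(1) connected_path_image[OF g(1)]] g(3,4)
    by (metis pathfinish_in_path_image pathstart_in_path_image)
  then show False
    using g(2) det_orthogonal_matrix[of B] by force
qed

section \<open>The Gram operator and Schur's lemma\<close>

lemma permutation_group_bij:
  assumes "subgroup \<Gamma> (BijGroup UNIV)" "\<phi> \<in> \<Gamma>"
  shows "bij \<phi>"
  using subgroup.subset[OF assms(1)] assms(2) by (auto simp: BijGroup_def Bij_def)

lemma representation_of_orthogonal:
  assumes "representation_of \<Gamma> v T" "\<phi> \<in> \<Gamma>"
  shows "orthogonal_transformation (T \<phi>)"
  using assms by (auto simp: representation_of_def orthogonal_representation_def
      orthogonal_group_def hom_def)

lemma representation_of_linear:
  assumes "representation_of \<Gamma> v T" "\<phi> \<in> \<Gamma>"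
  shows "linear (T \<phi>)"
  using representation_of_orthogonal[OF assms] by (simp add: orthogonal_transformation_def)

lemma gram_apply:
  fixes v :: "real^'d^'n" and w :: "real^'e^'n"
  shows "(transpose w ** v) *v x = (\<Sum>i\<in>UNIV. (v $ i \<bullet> x) *\<^sub>R w $ i)"
proof -
  have "(transpose w ** v) *v x = transpose w *v (v *v x)"
    by (simp only: matrix_vector_mul_assoc)
  also have "\<dots> = (\<Sum>i\<in>UNIV. (v *v x) $ i *s column i (transpose w))"
    by (rule matrix_mult_sum)
  also have "\<dots> = (\<Sum>i\<in>UNIV. (v $ i \<bullet> x) *\<^sub>R w $ i)"
    by (simp add: matrix_vector_mul_component scalar_mult_eq_scaleR row_def)
  finally show ?thesis .
qed

text \<open>
  Reindex \<open>\<Sum>\<^sub>i (v\<^sub>i \<bullet> T\<^sub>\<phi> x) w\<^sub>i\<close> by \<open>\<phi>\<close>; then \<open>T\<^sub>\<phi>\<close> cancels in the inner product because it is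
  orthogonal, and \<open>T'\<^sub>\<phi>\<close> can be pulled out of the sum.
\<close>

lemma gram_intertwines:
  fixes v w :: "real^'d^'n::finite"
  assumes "subgroup \<Gamma> (BijGroup UNIV)" "representation_of \<Gamma> v T" "representation_of \<Gamma> w T'" "\<phi> \<in> \<Gamma>"
  shows "(transpose w ** v) *v T \<phi> x = T' \<phi> ((transpose w ** v) *v x)"
proof -
  note lin = representation_of_linear[OF assms(3,4)]
  have inner: "T \<phi> a \<bullet> T \<phi> b = a \<bullet> b" for a b
    using representation_of_orthogonal[OF assms(2,4)] by (simp add: orthogonal_transformation_def)
  have "(transpose w ** v) *v T \<phi> x = (\<Sum>i\<in>UNIV. (v $ i \<bullet> T \<phi> x) *\<^sub>R w $ i)"
    by (rule gram_apply)
  also have "\<dots> = (\<Sum>i\<in>UNIV. (v $ \<phi> i \<bullet> T \<phi> x) *\<^sub>R w $ \<phi> i)"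
    by (rule sum.reindex_bij_betw[OF permutation_group_bij[OF assms(1,4)],
          of "\<lambda>i. (v $ i \<bullet> T \<phi> x) *\<^sub>R w $ i", symmetric])
  also have "\<dots> = (\<Sum>i\<in>UNIV. (T \<phi> (v $ i) \<bullet> T \<phi> x) *\<^sub>R T' \<phi> (w $ i))"
    using assms(2-4) by (simp add: representation_of_def)
  also have "\<dots> = T' \<phi> (\<Sum>i\<in>UNIV. (v $ i \<bullet> x) *\<^sub>R w $ i)"
    by (simp add: inner linear_sum[OF lin] linear_scale[OF lin])
  finally show ?thesis
    by (simp only: gram_apply)
qed

text \<open>
  An eigenspace of \<open>A\<close> for a real eigenvalue is invariant and not zero, hence everything.  In even
  dimension \<open>A\<close> need not have a real eigenvalue, and the commuting algebra can be complex or
  quaternionic.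
\<close>

lemma odd_dimension_schur:
  fixes A :: "real^'d^'d"
  assumes "odd CARD('d)" "irreducible_representation \<Gamma> T"
    and "\<And>\<phi>. \<phi> \<in> \<Gamma> \<Longrightarrow> linear (T \<phi>)"
    and "\<And>\<phi> x. \<phi> \<in> \<Gamma> \<Longrightarrow> A *v T \<phi> x = T \<phi> (A *v x)"
  obtains c where "A = mat c"
proof -
  obtain c x where x: "x \<noteq> 0" "A *v x = c *\<^sub>R x"
    using odd_dimension_eigenvector[OF assms(1)] by blast
  define W where "W = {y. A *v y = c *\<^sub>R y}"
  have "subspace W"
    by (auto simp: W_def subspace_def matrix_vector_right_distrib scaleR_right_distrib matrix_vector_mult_scaleR)
  moreover have "\<forall>\<phi>\<in>\<Gamma>. T \<phi> ` W \<subseteq> W"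
    using assms(3,4) by (auto simp: W_def linear_scale)
  ultimately have "W = {0} \<or> W = UNIV"
    using assms(2) by (auto simp: irreducible_representation_def)
  then have "W = UNIV"
    using x by (auto simp: W_def)
  then have "A *v y = mat c *v y" for y
    by (auto simp: W_def mat_mul_vector)
  then show ?thesis
    using that matrix_eq by blast
qed

lemma norm_of_scalar_gram:
  fixes u :: "real^'d^'n"
  assumes "transpose u ** u = mat c"
  shows "(norm u)\<^sup>2 = c * CARD('d)"
proof -
  have "(norm u)\<^sup>2 = (\<Sum>i\<in>UNIV. \<Sum>k\<in>UNIV. u $ i $ k * u $ i $ k)"
    by (simp add: power2_norm_eq_inner inner_vec_def)
  also have "\<dots> = (\<Sum>k\<in>UNIV. (transpose u ** u) $ k $ k)"
    by (simp add: matrix_matrix_mult_def transpose_def, rule sum.swap)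
  also have "\<dots> = c * CARD('d)"
    unfolding assms by (simp add: mat_def)
  finally show ?thesis .
qed

text \<open>
  The matrix is scalar because it commutes with \<open>T\<close>; the scalar is read off from the trace.
  Consequently \<open>u\<close> is normalized if and only if its norm is \<open>sqrt d\<close>, where \<open>d = CARD('d)\<close>.
\<close>

lemma irreducible_gram_scalar:
  fixes u :: "real^'d^'n"
  assumes "odd CARD('d)" "subgroup \<Gamma> (BijGroup UNIV)"
    and "representation_of \<Gamma> u T" "irreducible_representation \<Gamma> T"
  shows "transpose u ** u = mat ((norm u)\<^sup>2 / CARD('d))"
proof -
  obtain c where c: "transpose u ** u = mat c"
    using odd_dimension_schur[OF assms(1,4) representation_of_linear[OF assms(3)]
        gram_intertwines[OF assms(2,3,3)]] by blast
  then show ?thesis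
    using norm_of_scalar_gram[OF c] by simp
qed

section \<open>The sphere of normalized arrangements with a given representation\<close>

lemma representation_of_scaleR:
  assumes "representation_of \<Gamma> v T"
  shows "representation_of \<Gamma> (c *\<^sub>R v) T"
proof -
  have "T \<phi> ((c *\<^sub>R v) $ i) = (c *\<^sub>R v) $ \<phi> i" if "\<phi> \<in> \<Gamma>" for \<phi> i
  proof -
    have "T \<phi> (c *\<^sub>R v $ i) = c *\<^sub>R T \<phi> (v $ i)"
      by (rule linear_scale[OF representation_of_linear[OF assms that]])
    then show ?thesis
      using assms that by (simp add: representation_of_def)
  qed
  then show ?thesis
    using assms by (simp add: representation_of_def)
qed

lemma representation_of_add:
  assumes "representation_of \<Gamma> v T" "representation_of \<Gamma> w T"
  shows "representation_of \<Gamma> (v + w) T"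
proof -
  have "T \<phi> ((v + w) $ i) = (v + w) $ \<phi> i" if "\<phi> \<in> \<Gamma>" for \<phi> i
  proof -
    have "T \<phi> (v $ i + w $ i) = T \<phi> (v $ i) + T \<phi> (w $ i)"
      by (rule linear_add[OF representation_of_linear[OF assms(1) that]])
    then show ?thesis
      using assms that by (simp add: representation_of_def)
  qed
  then show ?thesis
    using assms by (simp add: representation_of_def)
qed

lemma mat_scaleR: "c *\<^sub>R mat a = (mat (c * a) :: real^'d^'d)"
  by (simp add: vec_eq_iff mat_def)

lemma scaleR_gram: "transpose (c *\<^sub>R u) ** (c *\<^sub>R u) = c\<^sup>2 *\<^sub>R (transpose u ** (u :: real^'d^'n))"
proof -
  have "transpose (c *\<^sub>R u) ** (c *\<^sub>R u) = (c *\<^sub>R transpose u) ** (c *\<^sub>R u)"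
    by (simp only: transpose_scalar)
  also have "\<dots> = c\<^sup>2 *\<^sub>R (transpose u ** u)"
    by (simp add: matrix_scalar_ac scalar_matrix_assoc[symmetric] power2_eq_square)
  finally show ?thesis .
qed

lemma normalize_equivariant:
  fixes u :: "real^'d^'n"
  assumes "odd CARD('d)" "subgroup \<Gamma> (BijGroup UNIV)"
    and "representation_of \<Gamma> u T" "irreducible_representation \<Gamma> T" "u \<noteq> 0"
  shows "(sqrt CARD('d) / norm u) *\<^sub>R u \<in> normalized_arrangements \<Gamma>"
proof -
  have "normalized ((sqrt CARD('d) / norm u) *\<^sub>R u)"
    unfolding normalized_def scaleR_gram irreducible_gram_scalar[OF assms(1-4)] mat_scaleR
    using assms(5) by (simp add: power_divide)
  then show ?thesis
    using representation_of_scaleR[OF assms(3)]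
    by (auto simp: normalized_arrangements_def symmetric_arrangement_def)
qed

text \<open>
  The families with representation \<open>T\<close> form a linear space, and the straight segment from \<open>u\<close> to
  \<open>v\<close> is projected to the sphere of radius \<open>sqrt d\<close>, \<open>d = CARD('d)\<close>.  As \<open>u\<close> and \<open>v\<close> have equal
  norm, the segment could meet \<open>0\<close> only at its midpoint, which would mean \<open>u = - v\<close>.
\<close>

lemma same_representation_not_antipodal:
  fixes u v :: "real^'d^'n"
  assumes "odd CARD('d)" "subgroup \<Gamma> (BijGroup UNIV)"
    and "representation_of \<Gamma> u T" "representation_of \<Gamma> v T" "irreducible_representation \<Gamma> T"
    and "normalized u" "normalized v" "u \<noteq> - v"
  shows "path_component (normalized_arrangements \<Gamma>) u v"
proof -
  define f :: "real^'d^'n \<Rightarrow> real^'d^'n" where "f x = (sqrt CARD('d) / norm x) *\<^sub>R x" for x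
  have norm_eq: "norm x = sqrt CARD('d)" if "normalized x" for x :: "real^'d^'n"
    using norm_of_scalar_gram[of x 1] that by (metis mult_1 norm_ge_zero normalized_def real_sqrt_unique)
  have ends: "f u = u" "f v = v"
    using assms(6,7) by (simp_all add: f_def norm_eq)
  have nz: "0 \<notin> closed_segment u v"
  proof
    assume "0 \<in> closed_segment u v"
    then obtain t where t: "0 \<le> t" "t \<le> 1" "(1 - t) *\<^sub>R u + t *\<^sub>R v = 0"
      by (auto simp: closed_segment_def)
    then have eq: "(1 - t) *\<^sub>R u = - (t *\<^sub>R v)"
      by (simp add: eq_neg_iff_add_eq_0)
    then have "norm ((1 - t) *\<^sub>R u) = norm (t *\<^sub>R v)"
      by simp
    then have "t = 1/2"
      using t assms(6,7) by (simp add: norm_eq)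
    with eq have "(1/2) *\<^sub>R u = (1/2) *\<^sub>R (- v)"
      by simp
    with assms(8) show False
      by (simp only: scaleR_cancel_left) simp
  qed
  have "path_component (closed_segment u v) u v"
    using path_connected_component by (metis convex_closed_segment convex_imp_path_connected ends_in_segment)
  moreover have "continuous_on (closed_segment u v) f"
    unfolding f_def using nz by (intro continuous_intros) auto
  moreover have "f ` closed_segment u v \<subseteq> normalized_arrangements \<Gamma>"
  proof clarify
    fix x assume x: "x \<in> closed_segment u v"
    then have "representation_of \<Gamma> x T"
      using assms(3,4) by (auto simp: closed_segment_def intro!: representation_of_add representation_of_scaleR)
    moreover have "x \<noteq> 0"
      using x nz by blast
    ultimately show "f x \<in> normalized_arrangements \<Gamma>"
      unfolding f_def using assms by (intro normalize_equivariant)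
  qed
  ultimately have "path_component (normalized_arrangements \<Gamma>) (f u) (f v)"
    by (rule path_component_continuous_image)
  then show ?thesis
    by (simp add: ends)
qed

section \<open>Deforming into a prescribed representation\<close>

lemma arrangement_space_eq_range: "arrangement_space v = range ((*v) v)"
  for v :: "real^'d^'n"
proof
  show "arrangement_space v \<subseteq> range ((*v) v)"
    unfolding arrangement_space_def
    by (intro span_minimal linear_subspace_image) (auto simp: columns_image_basis)
  show "range ((*v) v) \<subseteq> arrangement_space v"
    unfolding arrangement_space_def by (auto intro: matrix_vector_mult_in_columnspace)
qed

lemma arrangement_space_mult_invertible:
  fixes v :: "real^'d^'n" and A :: "real^'d^'d"
  assumes "invertible A"
  shows "arrangement_space (v ** A) = arrangement_space v"
proof -
  have "range ((*v) A) = UNIV"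
    using assms by (metis invertible_right_inverse matrix_right_invertible_surjective)
  then have "range ((*v) v) = (*v) v ` range ((*v) A)"
    by simp
  then show ?thesis
    by (simp add: arrangement_space_eq_range image_image matrix_vector_mul_assoc)
qed

lemma arrangement_space_uminus: "arrangement_space (- v) = arrangement_space v"
  for v :: "real^'d^'n"
proof -
  have "invertible (- mat 1 :: real^'d^'d)"
    by (auto simp: invertible_def uminus_matrix_mult intro!: exI[of _ "- mat 1"])
  then show ?thesis
    using arrangement_space_mult_invertible[of "- mat 1" v] by (simp add: matrix_mult_uminus)
qed

lemma mult_transpose_nth: "(v ** transpose Q) $ i = Q *v (v $ i)"
  for v :: "real^'d^'n" and Q :: "real^'d^'e"
  by (simp add: vec_eq_iff matrix_matrix_mult_def matrix_vector_mult_def transpose_def mult.commute)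

text \<open>
  Rotating the points by \<open>Q\<close> conjugates the representation by \<open>Q\<close>.
\<close>

lemma rotated_normalized_arrangement:
  fixes v :: "real^'d^'n"
  assumes "v \<in> normalized_arrangements \<Gamma>" "orthogonal_matrix Q"
  shows "v ** transpose Q \<in> normalized_arrangements \<Gamma>"
proof -
  obtain T where T: "representation_of \<Gamma> v T"
    using assms(1) by (auto simp: normalized_arrangements_def symmetric_arrangement_def)
  let ?T = "\<lambda>\<phi>. (*v) Q \<circ> T \<phi> \<circ> (*v) (transpose Q)"
  have inv: "transpose Q *v (Q *v x) = x" for x
    using assms(2) by (metis matrix_vector_mul_assoc matrix_vector_mul_lid orthogonal_matrix_def)
  have orthT: "orthogonal_transformation (?T \<phi>)" if "\<phi> \<in> \<Gamma>" for \<phi>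
    by (intro orthogonal_transformation_compose representation_of_orthogonal[OF T that])
       (use assms(2) in \<open>auto simp: orthogonal_transformation_matrix\<close>)
  have "orthogonal_representation \<Gamma> ?T"
    using T orthT
    by (auto simp: representation_of_def orthogonal_representation_def hom_def orthogonal_group_def
        fun_eq_iff inv simp del: transpose_matrix_vector)
  moreover have "?T \<phi> ((v ** transpose Q) $ i) = (v ** transpose Q) $ \<phi> i" if "\<phi> \<in> \<Gamma>" for \<phi> i
    using T that by (simp add: mult_transpose_nth inv representation_of_def del: transpose_matrix_vector)
  ultimately have "representation_of \<Gamma> (v ** transpose Q) ?T"
    by (simp add: representation_of_def)
  moreover have "normalized (v ** transpose Q)"
    using assms by (simp add: normalized_def normalized_arrangements_def matrix_transpose_mul orthogonal_matrix_def)
      (metis matrix_mul_assoc matrix_mul_rid)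
  ultimately show ?thesis
    by (auto simp: normalized_arrangements_def symmetric_arrangement_def)
qed

text \<open>
  The points \<open>R v\<^sub>i\<close> have representation \<open>T\<close>, so by \<open>irreducible_gram_scalar\<close> their Gram matrix
  \<open>A transpose(A)\<close> is a scalar \<open>c\<close>, where \<open>A\<close> is the matrix of the isomorphism \<open>R\<close>.  Hence
  \<open>Q = A / sqrt c\<close> is orthogonal.  Replacing \<open>Q\<close> by \<open>- Q\<close> changes neither the representation nor
  the space, so \<open>Q\<close> may be taken in the path component of the identity, and the path from the
  identity to \<open>Q\<close> rotates \<open>v\<close> into the required arrangement.
\<close>

lemma deform_into_representation:
  fixes v w :: "real^'d^'n"
  assumes "odd CARD('d)" "subgroup \<Gamma> (BijGroup UNIV)"
    and "v \<in> normalized_arrangements \<Gamma>" "normalized w"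
    and "representation_of \<Gamma> w T" "irreducible_representation \<Gamma> T"
    and "have_isomorphic_representations \<Gamma> v w"
  obtains u where "u \<in> normalized_arrangements \<Gamma>" "representation_of \<Gamma> u T"
    "deformation_equivalent \<Gamma> v u" "equivalent_arrangements v u"
proof -
  obtain S T' R where S: "representation_of \<Gamma> v S" and T': "representation_of \<Gamma> w T'"
    and R: "linear R" "bij R" "\<And>\<phi>. \<phi> \<in> \<Gamma> \<Longrightarrow> R \<circ> S \<phi> = T' \<phi> \<circ> R"
    using assms(7) by (auto simp: have_isomorphic_representations_def isomorphic_representations_def)
  define A where "A = matrix R"
  have A: "A *v x = R x" for x
    using R(1) by (simp add: A_def)
  have det: "det A \<noteq> 0"
    using det_nz_iff_inj[OF R(1)] R(2) by (simp add: A_def bij_def)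
  have intertwine: "T \<phi> (R x) = R (S \<phi> x)" if "\<phi> \<in> \<Gamma>" for \<phi> x
    using R(3)[OF that] representation_of_unique[OF assms(4) T' assms(5) that] by (metis comp_apply)
  have rep: "representation_of \<Gamma> (v ** transpose A) T"
    using assms(5) S by (simp add: representation_of_def mult_transpose_nth A intertwine)
  define c where "c = (norm (v ** transpose A))\<^sup>2 / CARD('d)"
  have "transpose (v ** transpose A) ** (v ** transpose A) = mat c"
    unfolding c_def by (rule irreducible_gram_scalar[OF assms(1,2) rep assms(6)])
  moreover have "transpose v ** v = mat 1"
    using assms(3) by (simp add: normalized_arrangements_def normalized_def)
  ultimately have AA: "A ** transpose A = mat c"
    by (simp add: matrix_transpose_mul) (metis matrix_mul_assoc matrix_mul_rid)
  have "c \<noteq> 0"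
  proof
    assume "c = 0"
    then have "det (A ** transpose A) = 0"
      unfolding AA by (simp only: det_0)
    then show False
      using det by (simp add: det_mul)
  qed
  then have "c > 0"
    by (simp add: c_def)
  define Q where "Q = (1 / sqrt c) *\<^sub>R A"
  have "orthogonal_matrix (transpose Q)"
    using scaleR_gram[of "1 / sqrt c" "transpose A"] AA \<open>c > 0\<close>
    by (simp add: orthogonal_matrix Q_def transpose_scalar mat_scaleR power_divide)
  then have "orthogonal_matrix Q"
    by simp
  have repQ: "representation_of \<Gamma> (v ** transpose Q) T"
  proof -
    have "v ** transpose Q = (1 / sqrt c) *\<^sub>R (v ** transpose A)"
      by (simp add: Q_def transpose_scalar matrix_scalar_ac scalar_matrix_assoc)
    then show ?thesis
      by (simp add: representation_of_scaleR rep)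
  qed
  then have "representation_of \<Gamma> (v ** transpose (- Q)) T"
    using representation_of_scaleR[of \<Gamma> "v ** transpose Q" T "-1"]
    by (simp add: transpose_uminus matrix_mult_uminus)
  with repQ \<open>orthogonal_matrix Q\<close> odd_dimension_orthogonal_component[OF assms(1)]
  obtain B where B: "orthogonal_matrix B" "representation_of \<Gamma> (v ** transpose B) T"
      "path_component (Collect orthogonal_matrix) B (mat 1)"
    by (metis orthogonal_matrix_uminus)
  have "path_component (normalized_arrangements \<Gamma>) (v ** transpose (mat 1)) (v ** transpose B)"
    by (rule path_component_continuous_image[OF path_component_sym[OF B(3)]])
       (auto intro!: continuous_intros rotated_normalized_arrangement assms(3))
  moreover have "invertible (transpose B)"
    using B(1) by (auto simp: invertible_def orthogonal_matrix_def)
  ultimately show ?thesis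
    using that[of "v ** transpose B"] B rotated_normalized_arrangement[OF assms(3) B(1)]
    by (simp add: deformation_equivalent_def equivalent_arrangements_def arrangement_space_mult_invertible)
qed

section \<open>Deformations preserve the representation\<close>

lemma have_isomorphic_representations_sym:
  assumes "have_isomorphic_representations \<Gamma> v w"
  shows "have_isomorphic_representations \<Gamma> w v"
proof -
  obtain T T' R where T: "representation_of \<Gamma> v T" "representation_of \<Gamma> w T'"
    and R: "linear R" "bij R" "\<And>\<phi>. \<phi> \<in> \<Gamma> \<Longrightarrow> R \<circ> T \<phi> = T' \<phi> \<circ> R"
    using assms by (auto simp: have_isomorphic_representations_def isomorphic_representations_def)
  have "linear (inv_into UNIV R)"
    using R by (simp add: inj_linear_imp_inv_linear bij_is_inj)
  moreover have "inv_into UNIV R \<circ> T' \<phi> = T \<phi> \<circ> inv_into UNIV R" if "\<phi> \<in> \<Gamma>" for \<phi>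
  proof
    fix x
    show "(inv_into UNIV R \<circ> T' \<phi>) x = (T \<phi> \<circ> inv_into UNIV R) x"
      using R(2) R(3)[OF that] by (metis bij_inv_eq_iff comp_apply)
  qed
  ultimately show ?thesis
    using T R(2) bij_imp_bij_inv
    unfolding have_isomorphic_representations_def isomorphic_representations_def by blast
qed

text \<open>
  Normalization of the middle arrangement makes its representation unique on \<open>\<Gamma>\<close>, so the two
  isomorphisms can be composed.
\<close>

lemma have_isomorphic_representations_trans:
  assumes "have_isomorphic_representations \<Gamma> u v" "have_isomorphic_representations \<Gamma> v w" "normalized v"
  shows "have_isomorphic_representations \<Gamma> u w"
proof -
  obtain T T' R where T: "representation_of \<Gamma> u T" "representation_of \<Gamma> v T'"
    and R: "linear R" "bij R" "\<And>\<phi>. \<phi> \<in> \<Gamma> \<Longrightarrow> R \<circ> T \<phi> = T' \<phi> \<circ> R"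
    using assms(1) by (auto simp: have_isomorphic_representations_def isomorphic_representations_def)
  obtain U U' R' where U: "representation_of \<Gamma> v U" "representation_of \<Gamma> w U'"
    and R': "linear R'" "bij R'" "\<And>\<phi>. \<phi> \<in> \<Gamma> \<Longrightarrow> R' \<circ> U \<phi> = U' \<phi> \<circ> R'"
    using assms(2) by (auto simp: have_isomorphic_representations_def isomorphic_representations_def)
  have "(R' \<circ> R) \<circ> T \<phi> = U' \<phi> \<circ> (R' \<circ> R)" if "\<phi> \<in> \<Gamma>" for \<phi>
    using R(3)[OF that] R'(3)[OF that] representation_of_unique[OF assms(3) T(2) U(1) that]
    by (metis comp_assoc)
  then have "isomorphic_representations \<Gamma> T U'"
    using R R' unfolding isomorphic_representations_def
    by (intro exI[of _ "R' \<circ> R"]) (auto intro: linear_compose bij_comp)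
  then show ?thesis
    using T(1) U(2) by (auto simp: have_isomorphic_representations_def)
qed

lemma invertible_gram_isomorphic:
  fixes v w :: "real^'d^'n::finite"
  assumes "subgroup \<Gamma> (BijGroup UNIV)" "symmetric_arrangement \<Gamma> v" "symmetric_arrangement \<Gamma> w"
    and "det (transpose w ** v) \<noteq> 0"
  shows "have_isomorphic_representations \<Gamma> v w"
proof -
  obtain T T' where T: "representation_of \<Gamma> v T" "representation_of \<Gamma> w T'"
    using assms(2,3) by (auto simp: symmetric_arrangement_def)
  have "bij ((*v) (transpose w ** v))"
    using assms(4) by (simp add: invertible_det_nz[symmetric] invertible_eq_bij)
  then have "isomorphic_representations \<Gamma> T T'"
    unfolding isomorphic_representations_def using gram_intertwines[OF assms(1) T]
    by (intro exI[of _ "(*v) (transpose w ** v)"]) (auto simp: fun_eq_iff)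
  then show ?thesis
    using T by (auto simp: have_isomorphic_representations_def)
qed

text \<open>
  Having isomorphic representations is an equivalence relation on the path, and near each point
  \<open>a\<close> it holds because \<open>transpose x ** a\<close> stays invertible for \<open>x\<close> close to \<open>a\<close>.
\<close>

lemma deformation_imp_isomorphic_representations:
  fixes v w :: "real^'d^'n::finite"
  assumes "subgroup \<Gamma> (BijGroup UNIV)" "deformation_equivalent \<Gamma> v w"
  shows "have_isomorphic_representations \<Gamma> v w"
proof -
  obtain g where g: "path g" "path_image g \<subseteq> normalized_arrangements \<Gamma>" "pathstart g = v" "pathfinish g = w"
    using assms(2) by (auto simp: deformation_equivalent_def path_component_def)
  have sub: "symmetric_arrangement \<Gamma> x" "normalized x" if "x \<in> path_image g" for x
    using g(2) that by (auto simp: normalized_arrangements_def)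
  show ?thesis
  proof (rule connected_equivalence_relation[OF connected_path_image[OF g(1)]])
    show "v \<in> path_image g" "w \<in> path_image g"
      using g(3,4) pathstart_in_path_image pathfinish_in_path_image by metis+
  next
    fix x y assume "have_isomorphic_representations \<Gamma> x y"
    then show "have_isomorphic_representations \<Gamma> y x"
      by (rule have_isomorphic_representations_sym)
  next
    fix x y z
    assume "have_isomorphic_representations \<Gamma> x y" "have_isomorphic_representations \<Gamma> y z" "y \<in> path_image g"
    then show "have_isomorphic_representations \<Gamma> x z"
      using have_isomorphic_representations_trans sub(2) by blast
  next
    fix a assume a: "a \<in> path_image g"
    define N where "N = path_image g \<inter> (\<lambda>x. det (transpose x ** a)) -` (- {0})"
    have "openin (top_of_set (path_image g)) N"
      unfolding N_def by (intro continuous_openin_preimage_gen continuous_intros open_Compl closed_singleton)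
    moreover have "a \<in> N"
      using sub(2)[OF a] a by (simp add: N_def normalized_def)
    moreover have "\<forall>x\<in>N. have_isomorphic_representations \<Gamma> a x"
      using a by (auto simp: N_def intro!: invertible_gram_isomorphic[OF assms(1)] sub(1))
    ultimately show "\<exists>N. openin (top_of_set (path_image g)) N \<and> a \<in> N \<and>
        (\<forall>x\<in>N. have_isomorphic_representations \<Gamma> a x)"
      by blast
  qed
qed

section \<open>Classification of flexible irreducible arrangements\<close>

theorem theorem5p13:
  fixes \<Gamma> :: "('n::finite \<Rightarrow> 'n) set"
    and v w :: "real^'d^'n"
  assumes "odd CARD('d)"
    and "subgroup \<Gamma> (BijGroup UNIV)"
    and "v \<in> normalized_arrangements \<Gamma>" and "w \<in> normalized_arrangements \<Gamma>"
    and "irreducible_arrangement \<Gamma> v" and "irreducible_arrangement \<Gamma> w"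
    and "flexible \<Gamma> v" and "flexible \<Gamma> w"
  shows "deformation_equivalent \<Gamma> v w \<longleftrightarrow> have_isomorphic_representations \<Gamma> v w"
proof
  assume "deformation_equivalent \<Gamma> v w"
  then show "have_isomorphic_representations \<Gamma> v w"
    by (rule deformation_imp_isomorphic_representations[OF assms(2)])
next
  assume iso: "have_isomorphic_representations \<Gamma> v w"
  let ?P = "path_component (normalized_arrangements \<Gamma>)"
  obtain T where T: "representation_of \<Gamma> w T" and irred: "irreducible_representation \<Gamma> T"
    using assms(6) by (auto simp: irreducible_arrangement_def)
  have norm: "normalized x" if "x \<in> normalized_arrangements \<Gamma>" for x :: "real^'d^'n"
    using that by (simp add: normalized_arrangements_def)
  note deform = deform_into_representation[OF assms(1,2) _ norm[OF assms(4)] T irred]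
  note connect = same_representation_not_antipodal[OF assms(1,2) _ _ irred]
  obtain u where u: "u \<in> normalized_arrangements \<Gamma>" "representation_of \<Gamma> u T" "?P v u"
    using deform[OF assms(3) iso] by (auto simp: deformation_equivalent_def)
  have "?P u w"
  proof (cases "u = - w")
    case False
    then show ?thesis
      using connect[OF u(2) T norm[OF u(1)] norm[OF assms(4)]] by simp
  next
    case True
    \<comment> \<open>Moved into representation \<open>T\<close>, \<open>y\<close> becomes a detour point \<open>x\<close> other than \<open>w\<close> and \<open>- w\<close>.\<close>
    obtain y where y: "y \<in> normalized_arrangements \<Gamma>" "deformation_equivalent \<Gamma> w y"
        "\<not> equivalent_arrangements w y"
      using assms(8) by (auto simp: rigid_def)
    have "have_isomorphic_representations \<Gamma> y w"
      using deformation_imp_isomorphic_representations[OF assms(2) y(2)]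
      by (rule have_isomorphic_representations_sym)
    then obtain x where x: "x \<in> normalized_arrangements \<Gamma>" "representation_of \<Gamma> x T"
        "equivalent_arrangements y x"
      using deform[OF y(1)] by metis
    have "arrangement_space x \<noteq> arrangement_space w"
      using x(3) y(3) by (simp add: equivalent_arrangements_def)
    then have "x \<noteq> - w" "u \<noteq> - x"
      using True by (auto simp: arrangement_space_uminus)
    then have "?P u x" "?P x w"
      using connect[OF u(2) x(2) norm[OF u(1)] norm[OF x(1)]]
        connect[OF x(2) T norm[OF x(1)] norm[OF assms(4)]] by auto
    then show ?thesis
      by (rule path_component_trans)
  qed
  with u(3) show "deformation_equivalent \<Gamma> v w"
    unfolding deformation_equivalent_def by (rule path_component_trans)
qed

end
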